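(* Let $\mathbb K$ be a field of characteristic $0$, let $\Psi\in\mathbb K\langle\langle A,B\rangle\rangle$ be a semi-associator, and let $\Psi_t:=\Psi(t_{12},t_{23})\in\mathcal A_3$. Let $\rho:\mathcal B_3\to\mathcal A_3\rtimes\mathbb K[\Sigma_3]$ be the representation determined by $$\rho(\sigma_1)=\exp\left(\tfrac{t_{12}}2\right)\otimes s_1,\qquad\rho(\sigma_1\sigma_2\sigma_1)=\exp(T)\cdot\Psi_t^{-1}\otimes321,\qquad T=\tfrac12(t_{12}+t_{13}+t_{23}).$$ Then $\rho$ is given on the Artin generators by Drinfel'd's formulae, that is, $$\rho(\sigma_1)=\exp\left(\tfrac{t_{12}}2\right)\otimes s_1,\qquad\rho(\sigma_2)=\Psi_t^{-1}\cdot\left(\exp\left(\tfrac{t_{23}}2\right)\otimes s_2\right)\cdot\Psi_t.$$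
   Context: $\mathcal B_3=\langle\sigma_1,\sigma_2\mid\sigma_1\sigma_2\sigma_1=\sigma_2\sigma_1\sigma_2\rangle$; it is generated by $\sigma_1$ and $\Delta=\sigma_1\sigma_2\sigma_1$. For every semi-associator $\Psi$ the displayed values on $\sigma_1$ and $\Delta$ do define a representation of $\mathcal B_3$. $s_i=(i,i+1)\in\Sigma_3$. $\mathcal A_3$ is the complete Hopf algebra, the quotient of the completed free associative algebra $\mathbb K\langle\langle t_{ij}=t_{ji}\mid1\le i\ne j\le3\rangle\rangle$ ($t_{ij}$ primitive of degree 1) by the relations $[t_{ij},t_{ik}+t_{jk}]=0$ for $i,j,k$ distinct. $\Sigma_3$ acts on it by $\pi(t_{ij})=t_{\pi(i)\pi(j)}$, written ${}^{\pi}\Phi:=\pi(\Phi)$, and $ijk$ denotes the permutation $1\mapsto i,2\mapsto j,3\mapsto k$. $\mathcal A_3\rtimes\mathbb K[\Sigma_3]$ is $\mathcal A_3\otimes\mathbb K[\Sigma_3]$ with product $(a\otimes x)(b\otimes y)=a\cdot{}^{x}b\otimes xy$; an element $u\otimes\mathrm{id}$ is abbreviated $u$. Semi-associator: an element $\Psi\in\mathbb K\langle\langle A,B\rangle\rangle$ (completed free associative algebra) such that, with $s$ the involution exchanging $A$ and $B$: (AE) $\Psi=\exp(\psi)$ with $\psi$ in the complete free Lie algebra $\widehat{\mathbb L}\langle A,B\rangle$ having zero linear part; (AS) ${}^s\Psi=\Psi^{-1}$; (H1) $\exp(\frac{t_{12}+t_{13}}2)={}^{231}\Psi_t^{-1}\cdot\exp(\frac{t_{13}}2)\cdot{}^{213}\Psi_t\cdot\exp(\frac{t_{12}}2)\cdot\Psi_t^{-1}$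 in $\mathcal A_3$; (H3) $\exp(\frac{t_{13}+t_{23}}2)={}^{312}\Psi_t\cdot\exp(\frac{t_{13}}2)\cdot{}^{132}\Psi_t^{-1}\cdot\exp(\frac{t_{23}}2)\cdot\Psi_t$ in $\mathcal A_3$. *)

theory Defs
  imports Complex_Main "HOL-Library.Numeral_Type" "HOL-Combinatorics.Perm"
begin

section \<open>Generalities on rings and monoids\<close>

definition minv :: "'a::monoid_mult \<Rightarrow> 'a"
  where "minv x = (THE y. x * y = 1 \<and> y * x = 1)"

lemma minv_eqI:
  fixes x y :: "'a::monoid_mult"
  assumes "x * y = 1" "y * x = 1"
  shows "minv x = y"
  unfolding minv_def
proof (rule the_equality)
  show "x * y = 1 \<and> y * x = 1" using assms by simp
  fix z assume z: "x * z = 1 \<and> z * x = 1"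
  have "z = z * (x * y)" using assms by simp
  also have "\<dots> = y" using z by (simp flip: mult.assoc)
  finally show "z = y" .
qed

definition commutator :: "'a::ring \<Rightarrow> 'a \<Rightarrow> 'a"
  where "commutator x y = x * y - y * x"

inductive_set two_sided_ideal :: "'a::ring_1 set \<Rightarrow> 'a set" for R :: "'a set"
  where
    zero: "0 \<in> two_sided_ideal R"
  | add: "r \<in> R \<Longrightarrow> x \<in> two_sided_ideal R \<Longrightarrow> a * r * b + x \<in> two_sided_ideal R"

lemma two_sided_ideal_add:
  assumes "x \<in> two_sided_ideal R" "y \<in> two_sided_ideal R"
  shows "x + y \<in> two_sided_ideal R"
  using assms by (induction) (auto simp: add.assoc intro: two_sided_ideal.add)

lemma two_sided_ideal_mult:
  assumes "x \<in> two_sided_ideal R"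
  shows "c * x * d \<in> two_sided_ideal R"
  using assms
proof induction
  case zero
  then show ?case by (simp add: two_sided_ideal.zero)
next
  case (add r x a b)
  then have "(c * a) * r * (b * d) + c * x * d \<in> two_sided_ideal R"
    by (intro two_sided_ideal.add)
  then show ?case by (simp add: algebra_simps)
qed


section \<open>Completed free associative algebras\<close>

text \<open>
  The completed free associative algebra on an alphabet is the algebra of noncommutative
  formal power series: a series assigns a coefficient to every word.
\<close>

typedef ('x, 'k) ncps = "UNIV :: ('x list \<Rightarrow> 'k) set"
  morphisms coeff Series
  by simp

setup_lifting type_definition_ncps

lemma ncps_eqI: "(\<And>w. coeff f w = coeff g w) \<Longrightarrow> f = g"
  by (metis coeff_inject ext)

lemma coeff_Series [simp]: "coeff (Series f) = f"
  by (simp add: Series_inverse)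

instantiation ncps :: (type, ring_1) ring_1
begin

lift_definition zero_ncps :: "('a, 'b) ncps" is "\<lambda>w. 0" .

lift_definition one_ncps :: "('a, 'b) ncps" is "\<lambda>w. if w = [] then 1 else 0" .

lift_definition plus_ncps :: "('a, 'b) ncps \<Rightarrow> ('a, 'b) ncps \<Rightarrow> ('a, 'b) ncps"
  is "\<lambda>f g w. f w + g w" .

lift_definition minus_ncps :: "('a, 'b) ncps \<Rightarrow> ('a, 'b) ncps \<Rightarrow> ('a, 'b) ncps"
  is "\<lambda>f g w. f w - g w" .

lift_definition uminus_ncps :: "('a, 'b) ncps \<Rightarrow> ('a, 'b) ncps"
  is "\<lambda>f w. - f w" .

lift_definition times_ncps :: "('a, 'b) ncps \<Rightarrow> ('a, 'b) ncps \<Rightarrow> ('a, 'b) ncps"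
  is "\<lambda>f g w. \<Sum>i\<le>length w. f (take i w) * g (drop i w)" .

lemma coeff_simps:
  "coeff 0 w = 0"
  "coeff 1 w = (if w = [] then 1 else 0)"
  "coeff (f + g) w = coeff f w + coeff g w"
  "coeff (f - g) w = coeff f w - coeff g w"
  "coeff (- f) w = - coeff f w"
  for f g :: "('a, 'b) ncps"
  by (transfer; simp)+

lemma coeff_mult:
  "coeff (f * g) w = (\<Sum>i\<le>length w. coeff f (take i w) * coeff g (drop i w))"
  for f g :: "('a, 'b) ncps"
  by transfer simp

definition shift :: "'a \<Rightarrow> ('a, 'b) ncps \<Rightarrow> ('a, 'b) ncps"
  where "shift x f = Series (\<lambda>w. coeff f (x # w))"

lemma coeff_mult_Nil: "coeff (f * g) [] = coeff f [] * coeff g []"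
  for f g :: "('a, 'b) ncps"
  by (simp add: coeff_mult)

lemma coeff_mult_Cons:
  "coeff (f * g) (x # w) = coeff f [] * coeff g (x # w) + coeff (shift x f * g) w"
  for f g :: "('a, 'b) ncps"
  by (simp add: coeff_mult shift_def sum.atMost_Suc_shift del: sum.atMost_Suc)

lemma coeff_add_mult: "coeff ((f + g) * h) w = coeff (f * h) w + coeff (g * h) w"
  for f g h :: "('a, 'b) ncps"
  by (simp add: coeff_mult coeff_simps distrib_right sum.distrib)

lemma coeff_cmult_mult:
  "coeff (Series (\<lambda>w. c * coeff f w) * g) w = c * coeff (f * g) w"
  for f g :: "('a, 'b) ncps"
  by (simp add: coeff_mult sum_distrib_left mult.assoc)

lemma shift_mult:
  "shift x (f * g) = Series (\<lambda>w. coeff f [] * coeff (shift x g) w) + shift x f * g"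
  for f g :: "('a, 'b) ncps"
  by (rule ncps_eqI) (simp add: coeff_mult_Cons coeff_simps shift_def)

instance
proof
  fix f g h :: "('a, 'b) ncps"
  have "coeff (f * g * h) w = coeff (f * (g * h)) w" for w
  proof (induction w arbitrary: f)
    case Nil
    then show ?case by (simp add: coeff_mult_Nil mult.assoc)
  next
    case (Cons x w)
    show ?case
      by (simp add: coeff_mult_Cons coeff_mult_Nil shift_mult coeff_add_mult coeff_cmult_mult
          Cons.IH mult.assoc distrib_left add.assoc)
  qed
  then show "f * g * h = f * (g * h)" by (rule ncps_eqI)
  have "coeff (1 * f) w = coeff f w" for w
  proof (cases w)
    case Nil
    then show ?thesis by (simp add: coeff_mult_Nil coeff_simps)
  next
    case (Cons x v)
    have "shift x (1 :: ('a, 'b) ncps) = 0"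
      by (rule ncps_eqI) (simp add: shift_def coeff_simps)
    then show ?thesis using Cons
      by (simp add: coeff_mult_Cons coeff_simps) (simp add: coeff_mult coeff_simps)
  qed
  then show "1 * f = f" by (rule ncps_eqI)
  have "coeff (f * 1) w = coeff f w" for w
  proof (induction w arbitrary: f)
    case Nil
    then show ?case by (simp add: coeff_mult_Nil coeff_simps)
  next
    case (Cons x w)
    then show ?case by (simp add: coeff_mult_Cons coeff_simps) (simp add: shift_def)
  qed
  then show "f * 1 = f" by (rule ncps_eqI)
  show "(f + g) * h = f * h + g * h"
    by (rule ncps_eqI) (simp add: coeff_add_mult coeff_simps)
  show "f * (g + h) = f * g + f * h"
    by (rule ncps_eqI) (simp add: coeff_mult coeff_simps distrib_left sum.distrib)
  have "coeff (0 :: ('a, 'b) ncps) [] \<noteq> coeff 1 []"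
    by (simp add: coeff_simps)
  then show "(0 :: ('a, 'b) ncps) \<noteq> 1" by metis
qed (rule ncps_eqI; simp add: coeff_simps add.assoc add.commute)+

end

definition var :: "'x \<Rightarrow> ('x, 'k::ring_1) ncps"
  where "var x = Series (\<lambda>w. if w = [x] then 1 else 0)"

definition scale :: "'k \<Rightarrow> ('x, 'k::ring_1) ncps \<Rightarrow> ('x, 'k) ncps"
  where "scale c f = Series (\<lambda>w. c * coeff f w)"

lemma coeff_scale [simp]: "coeff (scale c f) w = c * coeff f w"
  by (simp add: scale_def)

lemma scale_eq_mult: "scale c f = scale c 1 * f"
  by (rule ncps_eqI) (use coeff_cmult_mult[of c 1 f] in \<open>simp add: scale_def\<close>)

lemma coeff_sum: "coeff (\<Sum>i\<in>A. f i) w = (\<Sum>i\<in>A. coeff (f i) w)"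
  for f :: "'i \<Rightarrow> ('x, 'k::ring_1) ncps"
  by (induction A rule: infinite_finite_induct) (simp_all add: coeff_simps)

text \<open>
  Closure for the topology given by the powers of the augmentation ideal: the series
  that are limits of elements of the given set.
\<close>

definition adic_closure :: "('x, 'k) ncps set \<Rightarrow> ('x, 'k) ncps set"
  where "adic_closure S = {f. \<forall>n. \<exists>g\<in>S. \<forall>w. length w < n \<longrightarrow> coeff f w = coeff g w}"

lemma adic_closureD:
  "f \<in> adic_closure S \<Longrightarrow> \<exists>g\<in>S. \<forall>w. length w < n \<longrightarrow> coeff f w = coeff g w"
  by (simp add: adic_closure_def)

lemma adic_closureI:
  "(\<And>n. \<exists>g\<in>S. \<forall>w. length w < n \<longrightarrow> coeff f w = coeff g w) \<Longrightarrow> f \<in> adic_closure S"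
  by (simp add: adic_closure_def)

lemma adic_closure_closed: "adic_closure (adic_closure S) = adic_closure S"
proof
  show "adic_closure (adic_closure S) \<subseteq> adic_closure S"
  proof (rule subsetI, rule adic_closureI)
    fix f n assume "f \<in> adic_closure (adic_closure S)"
    then obtain g where g: "g \<in> adic_closure S" "\<forall>w. length w < n \<longrightarrow> coeff f w = coeff g w"
      using adic_closureD by blast
    obtain h where h: "h \<in> S" "\<forall>w. length w < n \<longrightarrow> coeff g w = coeff h w"
      using adic_closureD[OF g(1)] by blast
    then show "\<exists>g\<in>S. \<forall>w. length w < n \<longrightarrow> coeff f w = coeff g w"
      using g by (intro bexI[of _ h]) auto
  qed
  show "adic_closure S \<subseteq> adic_closure (adic_closure S)"
    by (auto simp: adic_closure_def)
qed

lemma coeff_mult_cong: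
  assumes "\<And>w. length w < n \<Longrightarrow> coeff f w = coeff f' w"
    and "\<And>w. length w < n \<Longrightarrow> coeff g w = coeff g' w"
    and "length w < n"
  shows "coeff (f * g) w = coeff (f' * g') w"
  unfolding coeff_mult using assms by (intro sum.cong) auto

text \<open>
  The exponential series of \<open>f\<close> converges if \<open>f\<close> has no constant term; the value
  at \<open>w\<close> is then a finite sum, since the powers \<open>f ^ n\<close> with \<open>n > length w\<close> have
  coefficient zero at \<open>w\<close>.  The value \<open>0\<close> in the divergent case is a dummy.
\<close>

definition ncexp :: "('x, 'k::field_char_0) ncps \<Rightarrow> ('x, 'k) ncps"
  where "ncexp f =
    (if coeff f [] = 0 then Series (\<lambda>w. \<Sum>n\<le>length w. coeff (f ^ n) w / fact n) else 0)"

lemma coeff_power_eq_0: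
  fixes f :: "('x, 'k::ring_1) ncps"
  assumes "coeff f [] = 0" "length w < n"
  shows "coeff (f ^ n) w = 0"
  using assms(2)
proof (induction n arbitrary: w)
  case 0
  then show ?case by simp
next
  case (Suc n)
  show ?case unfolding power_Suc coeff_mult
  proof (intro sum.neutral ballI)
    fix i assume i: "i \<in> {..length w}"
    show "coeff f (take i w) * coeff (f ^ n) (drop i w) = 0"
    proof (cases "i = 0")
      case True
      then show ?thesis using assms(1) by simp
    next
      case False
      then have "coeff (f ^ n) (drop i w) = 0"
        using Suc.prems i by (intro Suc.IH) auto
      then show ?thesis by simp
    qed
  qed
qed

lemma coeff_ncexp_partial:
  fixes f :: "('x, 'k::field_char_0) ncps"
  assumes "coeff f [] = 0" "length w \<le> m"
  shows "coeff (ncexp f) w = coeff (\<Sum>n\<le>m. scale (1 / fact n) (f ^ n)) w"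
proof -
  have "(\<Sum>n\<le>m. coeff (f ^ n) w / fact n) = (\<Sum>n\<le>length w. coeff (f ^ n) w / fact n)"
    using assms by (intro sum.mono_neutral_right) (auto simp: coeff_power_eq_0)
  then show ?thesis
    using assms(1) by (simp add: ncexp_def coeff_sum)
qed


subsection \<open>Relabelling of the variables\<close>

text \<open>
  \<open>relabel h\<close> is the continuous algebra homomorphism sending the variable \<open>x\<close>
  to the variable \<open>h x\<close>.
\<close>

definition relabel :: "('x::finite \<Rightarrow> 'y) \<Rightarrow> ('x, 'k::ring_1) ncps \<Rightarrow> ('y, 'k) ncps"
  where "relabel h f = Series (\<lambda>w. \<Sum>v | map h v = w. coeff f v)"

lemma finite_map_eq: "finite {v :: 'x::finite list. map h v = w}"
proof (rule finite_subset)
  show "{v. map h v = w} \<subseteq> {v. set v \<subseteq> UNIV \<and> length v = length w}" by auto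
  show "finite {v :: 'x list. set v \<subseteq> UNIV \<and> length v = length w}"
    by (rule finite_lists_length_eq) simp
qed

lemma coeff_relabel_Nil: "coeff (relabel h f) [] = coeff f []"
  by (simp add: relabel_def)

lemma coeff_relabel_Cons:
  "coeff (relabel h f) (x # w) = (\<Sum>a | h a = x. coeff (relabel h (shift a f)) w)"
proof -
  have *: "{v. map h v = x # w} = (\<lambda>(a, v). a # v) ` ({a. h a = x} \<times> {v. map h v = w})"
    by (auto simp: Cons_eq_map_conv map_eq_Cons_conv image_iff)
  have "coeff (relabel h f) (x # w) =
      (\<Sum>(a, v)\<in>{a. h a = x} \<times> {v. map h v = w}. coeff f (a # v))"
    unfolding relabel_def coeff_Series *
    by (subst sum.reindex) (auto simp: inj_on_def case_prod_unfold)
  also have "\<dots> = (\<Sum>a | h a = x. \<Sum>v | map h v = w. coeff f (a # v))"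
    by (subst sum.cartesian_product) simp
  finally show ?thesis by (simp add: relabel_def shift_def)
qed

lemma relabel_add: "relabel h (f + g) = relabel h f + relabel h g"
  by (rule ncps_eqI) (simp add: relabel_def coeff_simps sum.distrib)

lemma relabel_diff: "relabel h (f - g) = relabel h f - relabel h g"
  by (rule ncps_eqI) (simp add: relabel_def coeff_simps sum_subtractf)

lemma relabel_0 [simp]: "relabel h 0 = 0"
  by (rule ncps_eqI) (simp add: relabel_def coeff_simps)

lemma relabel_1 [simp]: "relabel h 1 = (1 :: ('y, 'k::ring_1) ncps)"
proof (rule ncps_eqI)
  fix w
  show "coeff (relabel h 1) w = coeff (1 :: ('y, 'k) ncps) w"
    unfolding relabel_def coeff_Series
    by (cases w) (auto simp: coeff_simps intro!: sum.neutral)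
qed

lemma relabel_scale: "relabel h (scale c f) = scale c (relabel h f)"
  by (rule ncps_eqI) (simp add: relabel_def sum_distrib_left)

lemma relabel_mult: "relabel h (f * g) = relabel h f * relabel h g"
proof (rule ncps_eqI)
  fix w
  show "coeff (relabel h (f * g)) w = coeff (relabel h f * relabel h g) w"
  proof (induction w arbitrary: f)
    case Nil
    then show ?case by (simp add: coeff_relabel_Nil coeff_mult_Nil)
  next
    case (Cons x w)
    have sh: "shift x (relabel h f) = (\<Sum>a | h a = x. relabel h (shift a f))"
      by (rule ncps_eqI) (simp add: shift_def[of x] coeff_relabel_Cons coeff_sum)
    have sc: "shift a (f * g) = scale (coeff f []) (shift a g) + shift a f * g" for a
      by (simp add: shift_mult scale_def)
    show ?case
      by (simp add: coeff_relabel_Cons coeff_mult_Cons coeff_relabel_Nil sh sc relabel_add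
          relabel_scale coeff_simps sum.distrib Cons.IH sum_distrib_left sum_distrib_right
          coeff_sum)
  qed
qed

lemma relabel_var: "relabel h (var x) = (var (h x) :: ('y, 'k::ring_1) ncps)"
proof (rule ncps_eqI)
  fix w
  have "(\<Sum>v | map h v = w. if v = [x] then 1 else 0) = (if w = [h x] then 1 else (0::'k))"
    by (subst sum.delta[OF finite_map_eq]) auto
  then show "coeff (relabel h (var x)) w = coeff (var (h x) :: ('y, 'k) ncps) w"
    by (simp add: relabel_def var_def)
qed

lemma relabel_power: "relabel h (f ^ n) = relabel h f ^ n"
  by (induction n) (simp_all add: relabel_mult)

lemma relabel_cong:
  assumes "\<And>w. length w < n \<Longrightarrow> coeff f w = coeff g w" "length w < n"
  shows "coeff (relabel h f) w = coeff (relabel h g) w"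
  unfolding relabel_def coeff_Series
  by (rule sum.cong) (use assms in auto)

lemma relabel_relabel: "relabel h (relabel k f) = relabel (h \<circ> k) f"
  for k :: "'x::finite \<Rightarrow> 'y::finite"
proof (rule ncps_eqI)
  fix w
  show "coeff (relabel h (relabel k f)) w = coeff (relabel (h \<circ> k) f) w"
  proof -
    have "(\<Sum>v | map h v = w. \<Sum>u | map k u = v. coeff f u) =
      (\<Sum>(v, u)\<in>(SIGMA v:{v. map h v = w}. {u. map k u = v}). coeff f u)"
      by (rule sum.Sigma) (auto simp: finite_map_eq)
    also have "\<dots> = (\<Sum>u | map (h \<circ> k) u = w. coeff f u)"
      by (rule sum.reindex_bij_witness[of _ "\<lambda>u. (map k u, u)" snd]) auto
    finally show ?thesis by (simp add: relabel_def)
  qed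
qed

lemma relabel_id: "relabel id f = f"
  by (rule ncps_eqI) (simp add: relabel_def)


subsection \<open>Completed free Lie algebras\<close>

inductive_set lie_polynomials :: "('x, 'k::ring_1) ncps set"
  where
    var: "var x \<in> lie_polynomials"
  | scale: "f \<in> lie_polynomials \<Longrightarrow> scale c f \<in> lie_polynomials"
  | add: "f \<in> lie_polynomials \<Longrightarrow> g \<in> lie_polynomials \<Longrightarrow> f + g \<in> lie_polynomials"
  | bracket: "f \<in> lie_polynomials \<Longrightarrow> g \<in> lie_polynomials \<Longrightarrow>
      commutator f g \<in> lie_polynomials"

definition lie_series :: "('x, 'k::ring_1) ncps set"
  where "lie_series = adic_closure lie_polynomials"


section \<open>The algebra \<open>\<A>\<^sub>3\<close>\<close>

text \<open>
  The indices 1, 2, 3 are the elements of the type \<open>3\<close> (where \<open>3 = 0\<close>).  The variables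
  \<open>t\<^sub>i\<^sub>j = t\<^sub>j\<^sub>i\<close> with \<open>i \<noteq> j\<close> are encoded as two-element sets of indices.
\<close>

typedef edge = "{e :: 3 set. card e = 2}"
proof
  show "{1, 2} \<in> {e :: 3 set. card e = 2}" by simp
qed

setup_lifting type_definition_edge

instance edge :: finite
proof
  have "range Rep_edge \<subseteq> UNIV" by simp
  then have "finite (range Rep_edge)" by (rule finite_subset) simp
  then show "finite (UNIV :: edge set)"
    by (rule finite_imageD) (simp add: inj_on_def Rep_edge_inject)
qed

definition edge_of :: "3 \<Rightarrow> 3 \<Rightarrow> edge"
  where "edge_of i j = Abs_edge {i, j}"

lift_definition edge_act :: "3 perm \<Rightarrow> edge \<Rightarrow> edge"
  is "\<lambda>p e. Perm.apply p ` e"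
proof -
  fix p :: "3 perm" and e :: "3 set"
  assume "card e = 2"
  then show "card (Perm.apply p ` e) = 2"
    by (subst card_image) (auto simp: inj_on_def Perm.apply_inj)
qed

lemma edge_act_edge_of:
  assumes "i \<noteq> j"
  shows "edge_act p (edge_of i j) = edge_of (Perm.apply p i) (Perm.apply p j)"
  using assms
  by (simp add: edge_of_def edge_act.abs_eq eq_onp_def)

lemma edge_act_mult: "edge_act (p * q) e = edge_act p (edge_act q e)"
  by transfer (simp add: Perm.apply_times image_comp)

lemma edge_act_1: "edge_act 1 e = e"
  by transfer simp

definition A3_relators :: "(edge, 'k::ring_1) ncps set"
  where "A3_relators =
    {commutator (var (edge_of i j)) (var (edge_of i k) + var (edge_of j k)) | i j k.
      i \<noteq> j \<and> i \<noteq> k \<and> j \<noteq> k}"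

text \<open>
  The quotient of a complete algebra by relations is the quotient by the closed ideal
  that they generate.
\<close>

definition A3_ideal :: "(edge, 'k::ring_1) ncps set"
  where "A3_ideal = adic_closure (two_sided_ideal A3_relators)"

lemma A3_ideal_0: "0 \<in> A3_ideal"
  unfolding A3_ideal_def
  by (intro adic_closureI bexI[of _ 0]) (auto simp: two_sided_ideal.zero)

lemma A3_ideal_add:
  assumes "f \<in> A3_ideal" "g \<in> A3_ideal"
  shows "f + g \<in> A3_ideal"
  unfolding A3_ideal_def
proof (rule adic_closureI)
  fix n
  obtain f' where "f' \<in> two_sided_ideal A3_relators" "\<forall>w. length w < n \<longrightarrow> coeff f w = coeff f' w"
    using assms(1) adic_closureD unfolding A3_ideal_def by blast
  moreover obtain g' where "g' \<in> two_sided_ideal A3_relators"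
      "\<forall>w. length w < n \<longrightarrow> coeff g w = coeff g' w"
    using assms(2) adic_closureD unfolding A3_ideal_def by blast
  ultimately show "\<exists>h\<in>two_sided_ideal A3_relators.
      \<forall>w. length w < n \<longrightarrow> coeff (f + g) w = coeff h w"
    by (intro bexI[of _ "f' + g'"]) (auto simp: coeff_simps two_sided_ideal_add)
qed

lemma A3_ideal_mult:
  assumes "f \<in> A3_ideal"
  shows "a * f * b \<in> A3_ideal"
  unfolding A3_ideal_def
proof (rule adic_closureI)
  fix n
  obtain f' where f': "f' \<in> two_sided_ideal A3_relators"
      "\<forall>w. length w < n \<longrightarrow> coeff f w = coeff f' w"
    using assms adic_closureD unfolding A3_ideal_def by blast
  have "coeff (a * f * b) w = coeff (a * f' * b) w" if "length w < n" for w
    by (intro coeff_mult_cong[of n] that) (use f' in auto)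
  with f'(1) show "\<exists>h\<in>two_sided_ideal A3_relators.
      \<forall>w. length w < n \<longrightarrow> coeff (a * f * b) w = coeff h w"
    by (intro bexI[of _ "a * f' * b"]) (auto simp: two_sided_ideal_mult)
qed

lemma A3_ideal_mult_left: "f \<in> A3_ideal \<Longrightarrow> a * f \<in> A3_ideal"
  using A3_ideal_mult[of f a 1] by simp

lemma A3_ideal_mult_right: "f \<in> A3_ideal \<Longrightarrow> f * b \<in> A3_ideal"
  using A3_ideal_mult[of f 1 b] by simp

lemma A3_ideal_uminus: "f \<in> A3_ideal \<Longrightarrow> - f \<in> A3_ideal"
  using A3_ideal_mult_left[of f "- 1"] by simp

lemma A3_ideal_diff: "f \<in> A3_ideal \<Longrightarrow> g \<in> A3_ideal \<Longrightarrow> f - g \<in> A3_ideal"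
  using A3_ideal_add[of f "- g"] A3_ideal_uminus by auto

lemma A3_ideal_scale: "f \<in> A3_ideal \<Longrightarrow> scale c f \<in> A3_ideal"
  by (subst scale_eq_mult) (rule A3_ideal_mult_left)

lemma A3_ideal_sum: "(\<And>i. i \<in> S \<Longrightarrow> f i \<in> A3_ideal) \<Longrightarrow> (\<Sum>i\<in>S. f i) \<in> A3_ideal"
  by (induction S rule: infinite_finite_induct) (auto simp: A3_ideal_0 A3_ideal_add)

lemma A3_ideal_closed: "adic_closure A3_ideal = A3_ideal"
  by (simp add: A3_ideal_def adic_closure_closed)

lemma A3_ideal_const:
  assumes "f \<in> A3_ideal"
  shows "coeff f [] = 0"
proof -
  have "coeff g [] = 0" if "g \<in> two_sided_ideal A3_relators" for g :: "(edge, 'a) ncps"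
    using that
    by induction
      (auto simp: coeff_simps coeff_mult_Nil A3_relators_def commutator_def var_def)
  then show ?thesis
    using adic_closureD[of f _ 1] assms unfolding A3_ideal_def by force
qed

lemma A3_ideal_mult_cong:
  assumes "f - f' \<in> A3_ideal" "g - g' \<in> A3_ideal"
  shows "f * g - f' * g' \<in> A3_ideal"
proof -
  have "f * g - f' * g' = (f - f') * g + f' * (g - g')"
    by (simp add: algebra_simps)
  then show ?thesis
    using assms by (simp add: A3_ideal_add A3_ideal_mult_left A3_ideal_mult_right)
qed

lemma A3_ideal_power_cong:
  assumes "f - g \<in> A3_ideal"
  shows "f ^ n - g ^ n \<in> A3_ideal"
  by (induction n) (simp_all add: A3_ideal_0 A3_ideal_mult_cong assms)

lemma A3_ideal_ncexp_cong:
  fixes f g :: "(edge, 'k::field_char_0) ncps"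
  assumes "f - g \<in> A3_ideal"
  shows "ncexp f - ncexp g \<in> A3_ideal"
proof (cases "coeff f [] = 0")
  case False
  then have "coeff g [] \<noteq> 0"
    using A3_ideal_const[OF assms] by (simp add: coeff_simps)
  then show ?thesis using False by (simp add: ncexp_def A3_ideal_0)
next
  case True
  then have g0: "coeff g [] = 0"
    using A3_ideal_const[OF assms] by (simp add: coeff_simps)
  have "ncexp f - ncexp g \<in> adic_closure A3_ideal"
  proof (rule adic_closureI)
    fix m
    let ?p = "(\<Sum>n\<le>m. scale (1 / fact n) (f ^ n)) - (\<Sum>n\<le>m. scale (1 / fact n) (g ^ n))"
    have "?p = (\<Sum>n\<le>m. scale (1 / fact n) (f ^ n - g ^ n))"
      unfolding sum_subtractf[symmetric]
      by (intro sum.cong refl ncps_eqI) (simp add: coeff_simps algebra_simps)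
    also have "\<dots> \<in> A3_ideal"
      by (intro A3_ideal_sum A3_ideal_scale A3_ideal_power_cong assms)
    finally have "?p \<in> A3_ideal" .
    moreover have "coeff (ncexp f - ncexp g) w = coeff ?p w" if "length w < m" for w
      using that True g0 by (simp add: coeff_simps coeff_ncexp_partial[of _ w m])
    ultimately show "\<exists>h\<in>A3_ideal. \<forall>w. length w < m \<longrightarrow> coeff (ncexp f - ncexp g) w = coeff h w"
      by (intro bexI[of _ ?p]) auto
  qed
  then show ?thesis by (simp add: A3_ideal_closed)
qed

lemma relabel_edge_act_relator:
  assumes "r \<in> A3_relators"
  shows "relabel (edge_act p) r \<in> A3_relators"
proof -
  obtain i j k where *: "i \<noteq> j" "i \<noteq> k" "j \<noteq> k"
    "r = commutator (var (edge_of i j)) (var (edge_of i k) + var (edge_of j k))"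
    using assms unfolding A3_relators_def by blast
  let ?i = "Perm.apply p i" and ?j = "Perm.apply p j" and ?k = "Perm.apply p k"
  have "relabel (edge_act p) r =
      commutator (var (edge_of ?i ?j)) (var (edge_of ?i ?k) + var (edge_of ?j ?k))"
    using * by (simp add: commutator_def relabel_diff relabel_mult relabel_add relabel_var
        edge_act_edge_of)
  moreover have "?i \<noteq> ?j" "?i \<noteq> ?k" "?j \<noteq> ?k"
    using * by (simp_all add: Perm.apply_inj)
  ultimately show ?thesis unfolding A3_relators_def by blast
qed

lemma A3_ideal_relabel:
  assumes "f \<in> A3_ideal"
  shows "relabel (edge_act p) f \<in> A3_ideal"
  unfolding A3_ideal_def
proof (rule adic_closureI)
  fix n
  obtain g where g: "g \<in> two_sided_ideal A3_relators"
      "\<forall>w. length w < n \<longrightarrow> coeff f w = coeff g w"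
    using assms adic_closureD unfolding A3_ideal_def by blast
  from g(1) have "relabel (edge_act p) g \<in> two_sided_ideal A3_relators"
    by induction
      (auto simp: two_sided_ideal.zero relabel_add relabel_mult
        intro!: two_sided_ideal.add relabel_edge_act_relator)
  moreover have "coeff (relabel (edge_act p) f) w = coeff (relabel (edge_act p) g) w"
    if "length w < n" for w
    using g(2) that by (intro relabel_cong[of n]) auto
  ultimately show "\<exists>h\<in>two_sided_ideal A3_relators.
      \<forall>w. length w < n \<longrightarrow> coeff (relabel (edge_act p) f) w = coeff h w"
    by blast
qed

definition A3_eq :: "(edge, 'k::field_char_0) ncps \<Rightarrow> (edge, 'k) ncps \<Rightarrow> bool"
  where "A3_eq f g \<longleftrightarrow> f - g \<in> A3_ideal"

lemma equivp_A3_eq: "equivp (A3_eq :: (edge, 'k::field_char_0) ncps \<Rightarrow> _)"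
proof (rule equivpI)
  show "reflp (A3_eq :: (edge, 'k) ncps \<Rightarrow> _)"
    by (simp add: reflp_def A3_eq_def A3_ideal_0)
  show "symp (A3_eq :: (edge, 'k) ncps \<Rightarrow> _)"
    unfolding symp_def A3_eq_def using A3_ideal_uminus by fastforce
  show "transp (A3_eq :: (edge, 'k) ncps \<Rightarrow> _)"
    unfolding transp_def A3_eq_def using A3_ideal_add by fastforce
qed

quotient_type (overloaded) 'k A3 = "(edge, 'k::field_char_0) ncps" / A3_eq
  by (rule equivp_A3_eq)

instantiation A3 :: (field_char_0) ring_1
begin

lift_definition zero_A3 :: "'a A3" is 0 .

lift_definition one_A3 :: "'a A3" is 1 .

lift_definition plus_A3 :: "'a A3 \<Rightarrow> 'a A3 \<Rightarrow> 'a A3" is "(+)"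
proof -
  fix f f' g g' :: "(edge, 'a) ncps"
  assume "A3_eq f f'" "A3_eq g g'"
  then have "(f - f') + (g - g') \<in> A3_ideal"
    unfolding A3_eq_def by (rule A3_ideal_add)
  then show "A3_eq (f + g) (f' + g')" by (simp add: A3_eq_def algebra_simps)
qed

lift_definition minus_A3 :: "'a A3 \<Rightarrow> 'a A3 \<Rightarrow> 'a A3" is "(-)"
proof -
  fix f f' g g' :: "(edge, 'a) ncps"
  assume "A3_eq f f'" "A3_eq g g'"
  then have "(f - f') - (g - g') \<in> A3_ideal"
    unfolding A3_eq_def by (rule A3_ideal_diff)
  then show "A3_eq (f - g) (f' - g')" by (simp add: A3_eq_def algebra_simps)
qed

lift_definition uminus_A3 :: "'a A3 \<Rightarrow> 'a A3" is uminus
proof -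
  fix f f' :: "(edge, 'a) ncps"
  assume "A3_eq f f'"
  then have "- (f - f') \<in> A3_ideal"
    unfolding A3_eq_def by (rule A3_ideal_uminus)
  then show "A3_eq (- f) (- f')" by (simp add: A3_eq_def)
qed

lift_definition times_A3 :: "'a A3 \<Rightarrow> 'a A3 \<Rightarrow> 'a A3" is "(*)"
  unfolding A3_eq_def by (rule A3_ideal_mult_cong)

instance
proof
  show "(0 :: 'a A3) \<noteq> 1"
    by transfer (use A3_ideal_const[of "- 1 :: (edge, 'a) ncps"] in
        \<open>auto simp: A3_eq_def coeff_simps\<close>)
qed (transfer; simp add: algebra_simps equivp_reflp[OF equivp_A3_eq])+

end

lift_definition A3_scale :: "'k::field_char_0 \<Rightarrow> 'k A3 \<Rightarrow> 'k A3" (infixr "*\<^sub>A" 75)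
  is scale
proof -
  fix c :: 'k and f g :: "(edge, 'k) ncps"
  assume "A3_eq f g"
  then have "scale c (f - g) \<in> A3_ideal"
    unfolding A3_eq_def by (rule A3_ideal_scale)
  moreover have "scale c (f - g) = scale c f - scale c g"
    by (rule ncps_eqI) (simp add: coeff_simps algebra_simps)
  ultimately show "A3_eq (scale c f) (scale c g)" by (simp add: A3_eq_def)
qed

lift_definition A3_exp :: "'k::field_char_0 A3 \<Rightarrow> 'k A3" is ncexp
  unfolding A3_eq_def by (rule A3_ideal_ncexp_cong)

lift_definition A3_act :: "3 perm \<Rightarrow> 'k::field_char_0 A3 \<Rightarrow> 'k A3"
  is "\<lambda>p. relabel (edge_act p)"
  unfolding A3_eq_def by (metis A3_ideal_relabel relabel_diff)

text \<open>Only meaningful for \<open>i \<noteq> j\<close>.\<close>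

lift_definition t :: "3 \<Rightarrow> 3 \<Rightarrow> 'k::field_char_0 A3" is "\<lambda>i j. var (edge_of i j)" .

lemma t_sym: "t i j = t j i"
  by transfer (simp add: edge_of_def insert_commute equivp_reflp[OF equivp_A3_eq])

lemma t_relation:
  assumes "i \<noteq> j" "i \<noteq> k" "j \<noteq> k"
  shows "commutator (t i j) (t i k + t j k) = (0 :: 'k::field_char_0 A3)"
proof -
  have rel: "commutator (var (edge_of i j)) (var (edge_of i k) + var (edge_of j k))
      \<in> (A3_relators :: (edge, 'k) ncps set)" (is "?r \<in> _")
    using assms unfolding A3_relators_def by blast
  have "1 * ?r * 1 + 0 \<in> two_sided_ideal A3_relators"
    by (intro two_sided_ideal.intros rel)
  then have "?r \<in> A3_ideal"
    unfolding A3_ideal_def by (intro adic_closureI) auto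
  then show ?thesis
    unfolding commutator_def by transfer (simp add: A3_eq_def commutator_def)
qed

lemma A3_act_t:
  "i \<noteq> j \<Longrightarrow> A3_act p (t i j) = t (Perm.apply p i) (Perm.apply p j)"
  by transfer (simp add: relabel_var edge_act_edge_of equivp_reflp[OF equivp_A3_eq])

lemma A3_act_add: "A3_act p (a + b) = A3_act p a + A3_act p b"
  by transfer (simp add: relabel_add equivp_reflp[OF equivp_A3_eq])

lemma A3_act_mult: "A3_act p (a * b) = A3_act p a * A3_act p b"
  by transfer (simp add: relabel_mult equivp_reflp[OF equivp_A3_eq])

lemma A3_act_0 [simp]: "A3_act p 0 = 0"
  by transfer (simp add: equivp_reflp[OF equivp_A3_eq])

lemma A3_act_1 [simp]: "A3_act p 1 = 1"
  by transfer (simp add: equivp_reflp[OF equivp_A3_eq])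

lemma A3_act_one [simp]: "A3_act 1 a = a"
proof (induction a rule: A3.abs_induct)
  case (1 f)
  have "edge_act 1 = id" by (simp add: fun_eq_iff edge_act_1)
  then show ?case by (simp add: A3_act.abs_eq relabel_id)
qed

lemma A3_act_A3_act: "A3_act p (A3_act q a) = A3_act (p * q) a"
proof (induction a rule: A3.abs_induct)
  case (1 f)
  have "edge_act p \<circ> edge_act q = edge_act (p * q)" by (simp add: fun_eq_iff edge_act_mult)
  then show ?case by (simp add: A3_act.abs_eq relabel_relabel)
qed

lemma A3_act_sum: "A3_act p (\<Sum>i\<in>S. f i) = (\<Sum>i\<in>S. A3_act p (f i))"
  by (induction S rule: infinite_finite_induct) (simp_all add: A3_act_add)


section \<open>The algebra \<open>\<A>\<^sub>3 \<rtimes> \<K>[\<Sigma>\<^sub>3]\<close>\<close>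

instance perm :: (finite) finite
proof
  have "finite (range (Perm.apply :: 'a perm \<Rightarrow> 'a \<Rightarrow> 'a))"
    by (rule finite_subset[OF subset_UNIV]) simp
  then show "finite (UNIV :: 'a perm set)"
    by (rule finite_imageD) (simp add: inj_on_def Perm.apply_inject)
qed

text \<open>
  The tensor product with \<open>\<K>[\<Sigma>\<^sub>3]\<close> is a free \<open>\<A>\<^sub>3\<close>-module with basis \<open>\<Sigma>\<^sub>3\<close>;
  an element is given by its coordinates, \<open>\<Sum>x. a\<^sub>x \<otimes> x\<close> being \<open>x \<mapsto> a\<^sub>x\<close>.
\<close>

typedef (overloaded) 'k A3S3 = "UNIV :: (3 perm \<Rightarrow> 'k::field_char_0 A3) set"
  by simp

setup_lifting type_definition_A3S3

instantiation A3S3 :: (field_char_0) ring_1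
begin

lift_definition zero_A3S3 :: "'a A3S3" is "\<lambda>x. 0" .

lift_definition one_A3S3 :: "'a A3S3" is "\<lambda>x. if x = 1 then 1 else 0" .

lift_definition plus_A3S3 :: "'a A3S3 \<Rightarrow> 'a A3S3 \<Rightarrow> 'a A3S3" is "\<lambda>f g x. f x + g x" .

lift_definition minus_A3S3 :: "'a A3S3 \<Rightarrow> 'a A3S3 \<Rightarrow> 'a A3S3" is "\<lambda>f g x. f x - g x" .

lift_definition uminus_A3S3 :: "'a A3S3 \<Rightarrow> 'a A3S3" is "\<lambda>f x. - f x" .

lift_definition times_A3S3 :: "'a A3S3 \<Rightarrow> 'a A3S3 \<Rightarrow> 'a A3S3"
  is "\<lambda>f g z. \<Sum>x\<in>UNIV. f x * A3_act x (g (inverse x * z))" .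

instance
proof
  fix a b c :: "'a A3S3"
  show "a * b * c = a * (b * c)"
  proof transfer
    fix f g h :: "3 perm \<Rightarrow> 'a A3"
    show "(\<lambda>z. \<Sum>x\<in>UNIV. (\<Sum>y\<in>UNIV. f y * A3_act y (g (inverse y * x))) *
            A3_act x (h (inverse x * z))) =
          (\<lambda>z. \<Sum>y\<in>UNIV. f y * A3_act y (\<Sum>u\<in>UNIV. g u *
            A3_act u (h (inverse u * (inverse y * z)))))"
    proof
      fix z :: "3 perm"
      have "(\<Sum>x\<in>UNIV. (\<Sum>y\<in>UNIV. f y * A3_act y (g (inverse y * x))) *
            A3_act x (h (inverse x * z))) =
          (\<Sum>y\<in>UNIV. \<Sum>x\<in>UNIV. f y * A3_act y (g (inverse y * x)) *
            A3_act x (h (inverse x * z)))"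
        unfolding sum_distrib_right by (rule sum.swap)
      also have "\<dots> = (\<Sum>y\<in>UNIV. \<Sum>u\<in>UNIV. f y * A3_act y (g u) *
            A3_act (y * u) (h (inverse (y * u) * z)))"
      proof (rule sum.cong[OF refl])
        fix y :: "3 perm"
        show "(\<Sum>x\<in>UNIV. f y * A3_act y (g (inverse y * x)) *
            A3_act x (h (inverse x * z))) =
          (\<Sum>u\<in>UNIV. f y * A3_act y (g u) *
            A3_act (y * u) (h (inverse (y * u) * z)))"
          by (rule sum.reindex_bij_witness[of _ "\<lambda>u. y * u" "\<lambda>x. inverse y * x"])
            (simp_all flip: mult.assoc)
      qed
      also have "\<dots> = (\<Sum>y\<in>UNIV. f y * A3_act y (\<Sum>u\<in>UNIV. g u *
            A3_act u (h (inverse u * (inverse y * z)))))"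
        by (simp add: A3_act_sum A3_act_mult A3_act_A3_act sum_distrib_left mult.assoc)
      finally show "(\<Sum>x\<in>UNIV. (\<Sum>y\<in>UNIV. f y * A3_act y (g (inverse y * x))) *
            A3_act x (h (inverse x * z))) = (\<Sum>y\<in>UNIV. f y * A3_act y (\<Sum>u\<in>UNIV. g u *
            A3_act u (h (inverse u * (inverse y * z)))))" .
    qed
  qed
  show "1 * a = a"
  proof transfer
    fix f :: "3 perm \<Rightarrow> 'a A3"
    have "(if x = 1 then 1 else 0) * A3_act x (f (inverse x * z)) = (if x = 1 then f z else 0)"
      for x z by auto
    then show "(\<lambda>z. \<Sum>x\<in>UNIV. (if x = 1 then 1 else 0) * A3_act x (f (inverse x * z))) = f"
      by (simp add: fun_eq_iff)
  qed
  show "a * 1 = a"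
  proof transfer
    fix f :: "3 perm \<Rightarrow> 'a A3"
    have "inverse x * z = 1 \<longleftrightarrow> z = x" for x z :: "3 perm"
      by (metis mult.assoc mult_1_left mult_1_right perm.left_inverse perm.right_inverse)
    then have "f x * A3_act x (if inverse x * z = 1 then 1 else 0) = (if z = x then f x else 0)"
      for x z by auto
    then show "(\<lambda>z. \<Sum>x\<in>UNIV. f x * A3_act x (if inverse x * z = 1 then 1 else 0)) = f"
      by (simp add: fun_eq_iff)
  qed
  show "(a + b) * c = a * c + b * c"
    by transfer (simp add: fun_eq_iff distrib_right sum.distrib)
  show "a * (b + c) = a * b + a * c"
    by transfer (simp add: fun_eq_iff distrib_left A3_act_add sum.distrib)
  show "(0 :: 'a A3S3) \<noteq> 1"
    by transfer (metis zero_neq_one)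
qed (transfer; simp add: fun_eq_iff algebra_simps)+

end

definition tensor :: "'k::field_char_0 A3 \<Rightarrow> 3 perm \<Rightarrow> 'k A3S3" (infixl "\<otimes>" 68)
  where "a \<otimes> x = Abs_A3S3 (\<lambda>y. if y = x then a else 0)"

lemma tensor_mult: "(a \<otimes> x) * (b \<otimes> y) = a * A3_act x b \<otimes> x * y"
proof -
  have *: "inverse u * z = y \<longleftrightarrow> z = u * y" for u z :: "3 perm"
    by (metis mult.assoc mult_1_left perm.left_inverse perm.right_inverse)
  have "(if u = x then a else 0) * A3_act u (if inverse u * z = y then b else 0) =
      (if u = x then if z = x * y then a * A3_act x b else 0 else 0)" for u z
    by (auto simp: *)
  then have "(\<lambda>z. \<Sum>u\<in>UNIV. (if u = x then a else 0) *
      A3_act u (if inverse u * z = y then b else 0)) =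
      (\<lambda>z. if z = x * y then a * A3_act x b else 0)"
    by (simp add: fun_eq_iff)
  then show ?thesis
    by (simp add: tensor_def times_A3S3.abs_eq eq_onp_def)
qed

lemma tensor_one: "1 \<otimes> 1 = 1"
  by (simp add: tensor_def one_A3S3_def)

text \<open>
  \<open>perm3 i j k\<close> is the permutation \<open>1 \<mapsto> i, 2 \<mapsto> j, 3 \<mapsto> k\<close>,
  only meaningful for distinct \<open>i, j, k\<close>.
\<close>

definition perm3 :: "3 \<Rightarrow> 3 \<Rightarrow> 3 \<Rightarrow> 3 perm"
  where "perm3 i j k = Perm (\<lambda>x. if x = 1 then i else if x = 2 then j else k)"

lemma index3_cases: "x = 1 \<or> x = 2 \<or> x = (3::3)"
proof (cases x rule: bit1_cases)
  case (of_int z)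
  then have "z = 0 \<or> z = 1 \<or> z = 2" by auto
  then show ?thesis using of_int by auto
qed

lemma apply_perm3:
  assumes "i \<noteq> j" "i \<noteq> k" "j \<noteq> k"
  shows "Perm.apply (perm3 i j k) 1 = i" "Perm.apply (perm3 i j k) 2 = j"
    "Perm.apply (perm3 i j k) 3 = k"
proof -
  let ?f = "\<lambda>x::3. if x = 1 then i else if x = 2 then j else k"
  have "inj ?f"
  proof (rule injI)
    fix x y :: 3
    assume "?f x = ?f y"
    then show "x = y"
      using assms index3_cases[of x] index3_cases[of y] by (auto split: if_splits)
  qed
  then have "bij ?f"
    by (intro bijI finite_UNIV_inj_surj) auto
  then have "Perm.apply (perm3 i j k) = ?f"
    unfolding perm3_def by (intro Perm.Perm_inverse) simp
  then show "Perm.apply (perm3 i j k) 1 = i" "Perm.apply (perm3 i j k) 2 = j"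
    "Perm.apply (perm3 i j k) 3 = k"
    by simp_all
qed

abbreviation s1 :: "3 perm" where "s1 \<equiv> Perm.swap 1 2"

abbreviation s2 :: "3 perm" where "s2 \<equiv> Perm.swap 2 3"


section \<open>The braid group \<open>\<B>\<^sub>3\<close>\<close>

datatype artin = Sigma1 | Sigma2

text \<open>In a word, \<open>(s, True)\<close> stands for the generator \<open>s\<close> and \<open>(s, False)\<close> for its inverse.\<close>

inductive braid_eq :: "(artin \<times> bool) list \<Rightarrow> (artin \<times> bool) list \<Rightarrow> bool"
  where
    refl: "braid_eq u u"
  | sym: "braid_eq u v \<Longrightarrow> braid_eq v u"
  | trans: "braid_eq u v \<Longrightarrow> braid_eq v w \<Longrightarrow> braid_eq u w"
  | append: "braid_eq u v \<Longrightarrow> braid_eq u' v' \<Longrightarrow> braid_eq (u @ u') (v @ v')"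
  | cancel: "braid_eq [(s, e), (s, \<not> e)] []"
  | braid: "braid_eq [(Sigma1, True), (Sigma2, True), (Sigma1, True)]
      [(Sigma2, True), (Sigma1, True), (Sigma2, True)]"

quotient_type B3 = "(artin \<times> bool) list" / braid_eq
proof (rule equivpI)
  show "reflp braid_eq" by (rule reflpI) (rule braid_eq.refl)
  show "symp braid_eq" by (rule sympI) (rule braid_eq.sym)
  show "transp braid_eq" by (rule transpI) (rule braid_eq.trans)
qed

instantiation B3 :: "{monoid_mult, inverse}"
begin

lift_definition one_B3 :: B3 is "[]" .

lift_definition times_B3 :: "B3 \<Rightarrow> B3 \<Rightarrow> B3" is "(@)"
  by (rule braid_eq.append)

lift_definition inverse_B3 :: "B3 \<Rightarrow> B3" is "\<lambda>u. rev (map (map_prod id Not) u)"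
proof -
  fix u v assume "braid_eq u v"
  then show "braid_eq (rev (map (map_prod id Not) u)) (rev (map (map_prod id Not) v))"
  proof induction
    case braid
    let ?a = "(Sigma1, True)" and ?b = "(Sigma2, True)"
    let ?a' = "(Sigma1, False)" and ?b' = "(Sigma2, False)"
    let ?x = "[?a, ?b, ?a]" and ?y = "[?b, ?a, ?b]"
    let ?x' = "[?a', ?b', ?a']" and ?y' = "[?b', ?a', ?b']"
    have c: "braid_eq (p @ [(s, e), (s, \<not> e)] @ q) (p @ q)" for p q s e
      using braid_eq.append[OF braid_eq.refl[of p]
          braid_eq.append[OF braid_eq.cancel[of s e] braid_eq.refl[of q]]] by simp
    have y: "braid_eq (?y @ ?y') []"
      using c[of "[?b, ?a]" Sigma2 True "[?a', ?b']"] c[of "[?b]" Sigma1 True "[?b']"]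
        braid_eq.cancel[of Sigma2 True]
      by (simp, meson braid_eq.trans)
    have x: "braid_eq (?x' @ ?x) []"
      using c[of "[?a', ?b']" Sigma1 False "[?b, ?a]"] c[of "[?a']" Sigma2 False "[?a]"]
        braid_eq.cancel[of Sigma1 False]
      by (simp, meson braid_eq.trans)
    have 1: "braid_eq (?x' @ ?y @ ?y') (?x' @ [])"
      by (intro braid_eq.append braid_eq.refl y)
    have 2: "braid_eq (?x' @ ?x @ ?y') (?x' @ ?y @ ?y')"
      by (intro braid_eq.append braid_eq.refl braid_eq.braid)
    have 3: "braid_eq ((?x' @ ?x) @ ?y') ([] @ ?y')"
      by (intro braid_eq.append braid_eq.refl x)
    have "braid_eq ?x' ?y'"
      using braid_eq.trans[OF braid_eq.sym[OF braid_eq.trans[OF 2 1]]] 3 by simp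
    then show ?case by simp
  qed (auto intro: braid_eq.intros)
qed

definition divide_B3 :: "B3 \<Rightarrow> B3 \<Rightarrow> B3" where "divide_B3 x y = x * inverse y"

instance
  by standard (transfer; simp add: braid_eq.refl)+

end

lemma B3_right_inverse: "x * inverse x = 1" for x :: B3
proof transfer
  fix u :: "(artin \<times> bool) list"
  show "braid_eq (u @ rev (map (map_prod id Not) u)) []"
  proof (induction u)
    case Nil
    then show ?case by (simp add: braid_eq.refl)
  next
    case (Cons a u)
    obtain s e where a: "a = (s, e)" by (cases a)
    have "braid_eq ([a] @ (u @ rev (map (map_prod id Not) u)) @ [(s, \<not> e)])
        ([a] @ [] @ [(s, \<not> e)])"
      by (intro braid_eq.append braid_eq.refl Cons.IH)
    moreover have "braid_eq ([a] @ [] @ [(s, \<not> e)]) []"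
      using braid_eq.cancel[of s e] a by simp
    ultimately show ?case using a by (auto simp: id_def intro: braid_eq.trans)
  qed
qed

lemma B3_left_inverse: "inverse x * x = 1" for x :: B3
proof -
  have "inverse (inverse x) = x"
    by transfer (simp add: rev_map comp_def map_prod_def case_prod_unfold braid_eq.refl)
  then show ?thesis using B3_right_inverse[of "inverse x"] by simp
qed

lift_definition \<sigma>\<^sub>1 :: B3 is "[(Sigma1, True)]" .

lift_definition \<sigma>\<^sub>2 :: B3 is "[(Sigma2, True)]" .

lemma braid_relation: "\<sigma>\<^sub>1 * \<sigma>\<^sub>2 * \<sigma>\<^sub>1 = \<sigma>\<^sub>2 * \<sigma>\<^sub>1 * \<sigma>\<^sub>2"
  by transfer (simp add: braid_eq.braid)

text \<open>
  A representation of \<open>\<B>\<^sub>3\<close> in an algebra; as \<open>\<B>\<^sub>3\<close> is a group, all its values are units.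
\<close>

definition braid_representation :: "(B3 \<Rightarrow> 'a::ring_1) \<Rightarrow> bool"
  where "braid_representation \<rho> \<longleftrightarrow> \<rho> 1 = 1 \<and> (\<forall>x y. \<rho> (x * y) = \<rho> x * \<rho> y)"


section \<open>Semi-associators\<close>

datatype letter = LetterA | LetterB

instance letter :: finite
proof
  have "UNIV = {LetterA, LetterB}" using letter.exhaust by auto
  then show "finite (UNIV :: letter set)" by (metis finite.emptyI finite_insert)
qed

fun swap_letters :: "letter \<Rightarrow> letter"
  where
    "swap_letters LetterA = LetterB"
  | "swap_letters LetterB = LetterA"

fun letter_edge :: "letter \<Rightarrow> edge"
  where
    "letter_edge LetterA = edge_of 1 2"
  | "letter_edge LetterB = edge_of 2 3"

text \<open>\<open>subst_t \<Psi>\<close> is \<open>\<Psi>\<^sub>t = \<Psi>(t\<^sub>1\<^sub>2, t\<^sub>2\<^sub>3)\<close>.\<close>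

definition subst_t :: "(letter, 'k::field_char_0) ncps \<Rightarrow> 'k A3"
  where "subst_t f = abs_A3 (relabel letter_edge f)"

lemma subst_t_simps:
  "subst_t (var LetterA) = t 1 2"
  "subst_t (var LetterB) = t 2 3"
  "subst_t 1 = 1"
  "subst_t (f + g) = subst_t f + subst_t g"
  "subst_t (f * g) = subst_t f * subst_t g"
  "subst_t (scale c f) = c *\<^sub>A subst_t f"
  by (simp_all add: subst_t_def relabel_var relabel_add relabel_mult relabel_scale
      t.abs_eq one_A3.abs_eq plus_A3.abs_eq times_A3.abs_eq A3_scale.abs_eq)

definition semi_associator :: "(letter, 'k::field_char_0) ncps \<Rightarrow> bool"
  where "semi_associator \<Psi> \<longleftrightarrow>
    (\<exists>\<psi>\<in>lie_series. (\<forall>x. coeff \<psi> [x] = 0) \<and> \<Psi> = ncexp \<psi>) \<and>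
    relabel swap_letters \<Psi> = minv \<Psi> \<and>
    A3_exp ((1/2) *\<^sub>A (t 1 2 + t 1 3)) =
      minv (A3_act (perm3 2 3 1) (subst_t \<Psi>)) * A3_exp ((1/2) *\<^sub>A t 1 3) *
      A3_act (perm3 2 1 3) (subst_t \<Psi>) * A3_exp ((1/2) *\<^sub>A t 1 2) * minv (subst_t \<Psi>) \<and>
    A3_exp ((1/2) *\<^sub>A (t 1 3 + t 2 3)) =
      A3_act (perm3 3 1 2) (subst_t \<Psi>) * A3_exp ((1/2) *\<^sub>A t 1 3) *
      minv (A3_act (perm3 1 3 2) (subst_t \<Psi>)) * A3_exp ((1/2) *\<^sub>A t 2 3) * subst_t \<Psi>"

end

theory Submission
  imports Defs
begin

text \<open>
  Since \<open>\<sigma>\<^sub>1\<close> is a unit, \<open>\<rho> \<sigma>\<^sub>2\<close> is the only \<open>X\<close> with \<open>\<rho> \<sigma>\<^sub>1 * X * \<rho> \<sigma>\<^sub>1 = \<rho> (\<sigma>\<^sub>1 * \<sigma>\<^sub>2 * \<sigma>\<^sub>1)\<close>, so it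
  suffices to check this equation for Drinfel'd's value of \<open>X\<close>.  Write \<open>P\<close> for \<open>subst_t \<Psi>\<close>.
  Moving all permutations to the right, the equation becomes
  \<open>exp (t\<^sub>1\<^sub>2/2) * \<^sup>2\<^sup>1\<^sup>3P\<inverse> * exp (t\<^sub>1\<^sub>3/2) * \<^sup>2\<^sup>3\<^sup>1P * exp (t\<^sub>2\<^sub>3/2) = exp T * P\<inverse>\<close>.

  By the antisymmetry (AS), the permutation \<open>321\<close>, which exchanges \<open>t\<^sub>1\<^sub>2\<close> and \<open>t\<^sub>2\<^sub>3\<close>, inverts \<open>P\<close>
  (\<open>A3_act_321_subst_t\<close>).  Hence \<open>\<^sup>2\<^sup>1\<^sup>3P\<inverse> = \<^sup>3\<^sup>1\<^sup>2P\<close> and \<open>\<^sup>2\<^sup>3\<^sup>1P = \<^sup>1\<^sup>3\<^sup>2P\<inverse>\<close>, and the left-hand side is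
  \<open>exp (t\<^sub>1\<^sub>2/2)\<close> times the right-hand side of the hexagon (H3), times \<open>P\<inverse>\<close>.  By (H3) it is
  therefore \<open>exp (t\<^sub>1\<^sub>2/2) * exp ((t\<^sub>1\<^sub>3 + t\<^sub>2\<^sub>3)/2) * P\<inverse>\<close>, and the two exponentials multiply to
  \<open>exp T\<close> because \<open>t\<^sub>1\<^sub>2\<close> commutes with \<open>t\<^sub>1\<^sub>3 + t\<^sub>2\<^sub>3\<close> in \<open>\<A>\<^sub>3\<close>.

  The analytic input is thus the functional equation of the exponential series for
  commuting arguments.  It is needed twice: for \<open>t\<^sub>1\<^sub>2\<close> and \<open>t\<^sub>1\<^sub>3 + t\<^sub>2\<^sub>3\<close>, which commute only
  modulo the relations, and in the free algebra for \<open>\<psi>\<close> and \<open>- \<psi>\<close>, which shows that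
  \<open>\<Psi> = exp \<psi>\<close> is a unit, so that \<open>minv \<Psi>\<close> is a genuine inverse.  Both cases follow from
  \<open>ncexp_add_mod\<close>, where the equation is proved modulo a closed subspace of series.
\<close>

section \<open>The exponential series for commuting arguments\<close>

lemma binomial_commuting:
  fixes x y :: "'a::ring_1"
  assumes "x * y = y * x"
  shows "(x + y) ^ n = (\<Sum>k\<le>n. of_nat (n choose k) * (x ^ k * y ^ (n - k)))"
proof (induction n)
  case 0
  then show ?case by simp
next
  case (Suc n)
  define c where "c k = (of_nat (n choose k) :: 'a)" for k
  have yx: "y * x ^ k = x ^ k * y" for k
    using power_commuting_commutes[OF assms, of k] by simp
  have cx: "x * (c k * b) = c k * (x * b)" "y * (c k * b) = c k * (y * b)" for k b
    unfolding c_def by (metis mult.assoc mult_of_nat_commute)+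
  have "(x + y) ^ Suc n = (\<Sum>k\<le>n. x * (c k * (x ^ k * y ^ (n - k)))) +
      (\<Sum>k\<le>n. y * (c k * (x ^ k * y ^ (n - k))))"
    by (simp add: Suc.IH c_def distrib_right sum_distrib_left sum.distrib)
  also have "(\<Sum>k\<le>n. x * (c k * (x ^ k * y ^ (n - k)))) =
      (\<Sum>k\<le>n. c k * (x ^ Suc k * y ^ (n - k)))"
    by (simp add: cx mult.assoc)
  also have "(\<Sum>k\<le>n. y * (c k * (x ^ k * y ^ (n - k)))) =
      (\<Sum>k\<le>n. c k * (x ^ k * y ^ (Suc n - k)))"
  proof (rule sum.cong[OF HOL.refl])
    fix k assume "k \<in> {..n}"
    then have "y * (x ^ k * y ^ (n - k)) = x ^ k * y ^ (Suc n - k)"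
      by (simp add: Suc_diff_le yx mult.assoc flip: mult.assoc[of y])
    then show "y * (c k * (x ^ k * y ^ (n - k))) = c k * (x ^ k * y ^ (Suc n - k))"
      by (simp add: cx)
  qed
  also have "\<dots> = (\<Sum>k\<le>Suc n. c k * (x ^ k * y ^ (Suc n - k)))"
    by (simp add: c_def binomial_eq_0)
  also have "\<dots> = y ^ Suc n + (\<Sum>k\<le>n. c (Suc k) * (x ^ Suc k * y ^ (n - k)))"
    by (subst sum.atMost_Suc_shift) (simp add: c_def)
  also have "(\<Sum>k\<le>n. c k * (x ^ Suc k * y ^ (n - k))) +
      (y ^ Suc n + (\<Sum>k\<le>n. c (Suc k) * (x ^ Suc k * y ^ (n - k)))) =
      y ^ Suc n + (\<Sum>k\<le>n. of_nat (Suc n choose Suc k) * (x ^ Suc k * y ^ (n - k)))"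
    by (simp add: c_def distrib_right sum.distrib)
  also have "\<dots> = (\<Sum>k\<le>Suc n. of_nat (Suc n choose k) * (x ^ k * y ^ (Suc n - k)))"
    by (subst sum.atMost_Suc_shift) simp
  finally show ?case .
qed

lemma scale_mult_left: "scale c f * g = scale c (f * g)"
  by (rule ncps_eqI) (simp add: coeff_mult sum_distrib_left mult.assoc)

lemma scale_mult_right: "f * scale c g = scale c (f * g)"
  for f :: "('x, 'k::field_char_0) ncps"
  by (rule ncps_eqI) (simp add: coeff_mult sum_distrib_left mult.left_commute)

lemma of_nat_mult_eq_scale: "of_nat n * f = scale (of_nat n) f"
  by (rule ncps_eqI, induction n) (simp_all add: coeff_simps distrib_right)

lemma scale_sum: "scale c (\<Sum>i\<in>S. f i) = (\<Sum>i\<in>S. scale c (f i))"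
  by (rule ncps_eqI) (simp add: coeff_sum sum_distrib_left)

lemma scale_scale: "scale c (scale d f) = scale (c * d) f"
  by (rule ncps_eqI) (simp add: mult.assoc)

lemma coeff_power_mult_power_eq_0:
  fixes f g :: "('x, 'k::ring_1) ncps"
  assumes "coeff f [] = 0" "coeff g [] = 0" "length w < i + j"
  shows "coeff (f ^ i * g ^ j) w = 0"
  unfolding coeff_mult
proof (intro sum.neutral ballI)
  fix l assume "l \<in> {..length w}"
  then have "length (take l w) < i \<or> length (drop l w) < j"
    using assms(3) by auto
  then show "coeff (f ^ i) (take l w) * coeff (g ^ j) (drop l w) = 0"
    using coeff_power_eq_0[OF assms(1)] coeff_power_eq_0[OF assms(2)]
    by (elim disjE) (simp_all only: mult_zero_left mult_zero_right)
qed

text \<open>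
  On words of length at most \<open>m\<close>, the product of the two exponential series only involves
  the terms \<open>x\<^sup>i y\<^sup>j\<close> with \<open>i + j \<le> m\<close>; collected by total degree, these are the right-hand
  sides of the binomial theorem divided by \<open>n!\<close>.  So the functional equation holds modulo
  any closed subspace containing the defects in the binomial theorem for \<open>x\<close> and \<open>y\<close>.
\<close>

lemma ncexp_add_mod:
  fixes x y :: "('x, 'k::field_char_0) ncps"
  assumes x: "coeff x [] = 0" and y: "coeff y [] = 0"
    and closed: "adic_closure I \<subseteq> I"
    and sum: "\<And>f (m :: nat). (\<And>n. f n \<in> I) \<Longrightarrow> (\<Sum>n\<le>m. f n) \<in> I"
    and scale: "\<And>c f. f \<in> I \<Longrightarrow> scale c f \<in> I"
    and binom: "\<And>n. (x + y) ^ n - (\<Sum>k\<le>n. of_nat (n choose k) * (x ^ k * y ^ (n - k))) \<in> I"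
  shows "ncexp (x + y) - ncexp x * ncexp y \<in> I"
proof -
  define X where "X i = scale (1 / fact i) (x ^ i)" for i
  define Y where "Y j = scale (1 / fact j) (y ^ j)" for j
  define D where
    "D n = (x + y) ^ n - (\<Sum>k\<le>n. of_nat (n choose k) * (x ^ k * y ^ (n - k)))" for n
  have summand: "scale (1 / fact n) (of_nat (n choose k) * (x ^ k * y ^ (n - k))) = X k * Y (n - k)"
    if "k \<le> n" for n k
    using that unfolding X_def Y_def
    by (simp add: of_nat_mult_eq_scale scale_mult_left scale_mult_right scale_scale
        binomial_fact mult.commute)
  have D: "scale (1 / fact n) (D n) =
      scale (1 / fact n) ((x + y) ^ n) - (\<Sum>k\<le>n. X k * Y (n - k))" for n
  proof -
    have "scale (1 / fact n) (D n) = scale (1 / fact n) ((x + y) ^ n) -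
        scale (1 / fact n) (\<Sum>k\<le>n. of_nat (n choose k) * (x ^ k * y ^ (n - k)))"
      unfolding D_def by (rule ncps_eqI) (simp add: coeff_simps right_diff_distrib)
    also have "scale (1 / fact n) (\<Sum>k\<le>n. of_nat (n choose k) * (x ^ k * y ^ (n - k))) =
        (\<Sum>k\<le>n. X k * Y (n - k))"
      unfolding scale_sum by (rule sum.cong[OF HOL.refl]) (simp add: summand)
    finally show ?thesis .
  qed
  have "ncexp (x + y) - ncexp x * ncexp y \<in> adic_closure I"
  proof (rule adic_closureI)
    fix m
    define h where "h = (\<Sum>n\<le>m. scale (1 / fact n) (D n))"
    have "h \<in> I"
      unfolding h_def D_def by (intro sum scale binom)
    moreover have "coeff (ncexp (x + y) - ncexp x * ncexp y) w = coeff h w" if "length w < m" for w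
    proof -
      have "coeff (ncexp x * ncexp y) w = coeff ((\<Sum>i\<le>m. X i) * (\<Sum>j\<le>m. Y j)) w"
        using that x y unfolding X_def Y_def
        by (intro coeff_mult_cong[of m]) (auto simp: coeff_ncexp_partial[of _ _ m])
      also have "\<dots> = (\<Sum>(i, j)\<in>{..m} \<times> {..m}. coeff (X i * Y j) w)"
        by (simp add: sum_product coeff_sum flip: sum.cartesian_product)
      also have "\<dots> = (\<Sum>(i, j)\<in>{(i, j). i + j \<le> m}. coeff (X i * Y j) w)"
      proof (rule sum.mono_neutral_right)
        show "\<forall>p\<in>{..m} \<times> {..m} - {(i, j). i + j \<le> m}.
            (case p of (i, j) \<Rightarrow> coeff (X i * Y j) w) = 0"
          using that unfolding X_def Y_def
          by (auto simp: scale_mult_left scale_mult_right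
              intro!: coeff_power_mult_power_eq_0[OF x y])
      qed auto
      also have "\<dots> = coeff (\<Sum>n\<le>m. \<Sum>k\<le>n. X k * Y (n - k)) w"
        by (simp add: sum.triangle_reindex_eq coeff_sum)
      finally have "coeff (ncexp x * ncexp y) w = coeff (\<Sum>n\<le>m. \<Sum>k\<le>n. X k * Y (n - k)) w" .
      moreover have "coeff (ncexp (x + y)) w = coeff (\<Sum>n\<le>m. scale (1 / fact n) ((x + y) ^ n)) w"
        using that x y by (intro coeff_ncexp_partial) (simp_all add: coeff_simps)
      ultimately show ?thesis
        by (simp add: h_def D sum_subtractf coeff_simps)
    qed
    ultimately show "\<exists>h\<in>I. \<forall>w. length w < m \<longrightarrow>
        coeff (ncexp (x + y) - ncexp x * ncexp y) w = coeff h w"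
      by blast
  qed
  then show ?thesis using closed by blast
qed

lemma ncexp_add_commuting:
  fixes x y :: "('x, 'k::field_char_0) ncps"
  assumes "coeff x [] = 0" "coeff y [] = 0" "x * y = y * x"
  shows "ncexp (x + y) = ncexp x * ncexp y"
proof -
  have "adic_closure {0 :: ('x, 'k) ncps} \<subseteq> {0}"
  proof
    fix f :: "('x, 'k) ncps" assume f: "f \<in> adic_closure {0}"
    have "coeff f w = coeff 0 w" for w
      using adic_closureD[OF f, of "Suc (length w)"] by simp
    then show "f \<in> {0}" by (simp add: ncps_eqI)
  qed
  moreover have "scale c (0 :: ('x, 'k) ncps) = 0" for c
    by (rule ncps_eqI) (simp add: coeff_simps)
  ultimately have "ncexp (x + y) - ncexp x * ncexp y \<in> {0}"
    using assms by (intro ncexp_add_mod) (auto simp: binomial_commuting intro!: sum.neutral)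
  then show ?thesis by simp
qed

lemma ncexp_0: "ncexp 0 = 1"
proof (rule ncps_eqI)
  fix w
  have "(\<Sum>n\<le>length w. coeff ((0 :: ('a, 'b) ncps) ^ n) w / fact n) =
      (\<Sum>n\<le>length w. if n = 0 then coeff 1 w else 0)"
    by (intro sum.cong) (simp_all add: coeff_simps power_0_left)
  then show "coeff (ncexp (0 :: ('a, 'b) ncps)) w = coeff 1 w"
    by (simp add: ncexp_def coeff_simps)
qed

lemma ncexp_uminus_inverse:
  assumes "coeff x [] = 0"
  shows "ncexp x * ncexp (- x) = 1" "ncexp (- x) * ncexp x = 1"
  using ncexp_add_commuting[of x "- x"] ncexp_add_commuting[of "- x" x] assms
  by (simp_all add: coeff_simps ncexp_0)

lemma relabel_ncexp: "relabel h (ncexp f) = ncexp (relabel h f)"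
proof (cases "coeff f [] = 0")
  case True
  show ?thesis
  proof (rule ncps_eqI)
    fix w
    have "coeff (relabel h (ncexp f)) w =
        coeff (relabel h (\<Sum>n\<le>length w. scale (1 / fact n) (f ^ n))) w"
      using True by (intro relabel_cong[of "Suc (length w)"] coeff_ncexp_partial) simp_all
    also have "relabel h (\<Sum>n\<le>m. scale (1 / fact n) (f ^ n)) =
        (\<Sum>n\<le>m. scale (1 / fact n) (relabel h f ^ n))" for m
      by (induction m) (simp_all only: sum.atMost_Suc atMost_0 sum.insert sum.empty finite.emptyI empty_iff not_False_eq_True add_0_right relabel_add relabel_scale relabel_power)
    also have "coeff (\<Sum>n\<le>length w. scale (1 / fact n) (relabel h f ^ n)) w =
        coeff (ncexp (relabel h f)) w"
      using True by (intro coeff_ncexp_partial[symmetric]) (simp_all add: coeff_relabel_Nil)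
    finally show "coeff (relabel h (ncexp f)) w = coeff (ncexp (relabel h f)) w" .
  qed
next
  case False
  then show ?thesis by (simp add: ncexp_def coeff_relabel_Nil)
qed

section \<open>Exponentials and the action of permutations in \<open>\<A>\<^sub>3\<close>\<close>

lemma abs_A3_eq_iff: "abs_A3 f = abs_A3 g \<longleftrightarrow> f - g \<in> A3_ideal"
  by (simp add: A3.abs_eq_iff A3_eq_def)

lemma abs_A3_of_nat: "abs_A3 (of_nat n) = of_nat n"
  by (induction n) (simp_all flip: zero_A3.abs_eq one_A3.abs_eq plus_A3.abs_eq)

lemma abs_A3_power: "abs_A3 (f ^ n) = abs_A3 f ^ n"
  by (induction n) (simp_all flip: one_A3.abs_eq times_A3.abs_eq)

lemma abs_A3_sum: "abs_A3 (\<Sum>i\<in>S. f i) = (\<Sum>i\<in>S. abs_A3 (f i))"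
  by (induction S rule: infinite_finite_induct)
    (simp_all flip: zero_A3.abs_eq plus_A3.abs_eq)

text \<open>
  Representatives of \<open>a\<close> and \<open>b\<close> commute only modulo the ideal, so the binomial theorem is
  applied in the quotient and read back as a congruence between series.
\<close>

lemma A3_exp_add_commuting:
  assumes "coeff x [] = 0" "coeff y [] = 0" "abs_A3 x * abs_A3 y = abs_A3 y * abs_A3 x"
  shows "A3_exp (abs_A3 x + abs_A3 y) = A3_exp (abs_A3 x) * A3_exp (abs_A3 y)"
proof -
  have "ncexp (x + y) - ncexp x * ncexp y \<in> A3_ideal"
  proof (rule ncexp_add_mod[OF assms(1,2)])
    fix n
    have "abs_A3 ((x + y) ^ n) =
        abs_A3 (\<Sum>k\<le>n. of_nat (n choose k) * (x ^ k * y ^ (n - k)))"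
      using binomial_commuting[OF assms(3), of n]
      by (simp add: abs_A3_sum abs_A3_power abs_A3_of_nat flip: times_A3.abs_eq plus_A3.abs_eq)
    then show "(x + y) ^ n - (\<Sum>k\<le>n. of_nat (n choose k) * (x ^ k * y ^ (n - k))) \<in> A3_ideal"
      by (simp only: abs_A3_eq_iff)
  qed (auto simp: A3_ideal_closed A3_ideal_scale intro!: A3_ideal_sum)
  then show ?thesis
    by (simp add: plus_A3.abs_eq times_A3.abs_eq A3_exp.abs_eq abs_A3_eq_iff)
qed

lemma A3_act_exp: "A3_act p (A3_exp a) = A3_exp (A3_act p a)"
  by (induction a rule: A3.abs_induct) (simp add: A3_act.abs_eq A3_exp.abs_eq relabel_ncexp)

lemma A3_act_scale: "A3_act p (c *\<^sub>A a) = c *\<^sub>A A3_act p a"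
  by (induction a rule: A3.abs_induct) (simp add: A3_act.abs_eq A3_scale.abs_eq relabel_scale)

text \<open>The defining relations of \<open>\<A>\<^sub>3\<close> say that \<open>t\<^sub>1\<^sub>2\<close> commutes with \<open>t\<^sub>1\<^sub>3 + t\<^sub>2\<^sub>3\<close>.\<close>

lemma A3_exp_T:
  "A3_exp ((1/2) *\<^sub>A t 1 2) * A3_exp ((1/2) *\<^sub>A (t 1 3 + t 2 3)) =
    (A3_exp ((1/2) *\<^sub>A (t 1 2 + t 1 3 + t 2 3)) :: 'k::field_char_0 A3)"
proof -
  define u where "u = (var (edge_of 1 2) :: (edge, 'k) ncps)"
  define v where "v = (var (edge_of 1 3) + var (edge_of 2 3) :: (edge, 'k) ncps)"
  let ?x = "scale (1/2) u" and ?y = "scale (1/2) v"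
  have uv: "abs_A3 u = t 1 2" "abs_A3 v = t 1 3 + t 2 3"
    by (simp_all add: u_def v_def t.abs_eq plus_A3.abs_eq)
  have "abs_A3 (u * v) = abs_A3 (v * u)"
    using t_relation[of 1 2 3, where 'k='k] by (simp add: commutator_def uv flip: times_A3.abs_eq)
  then have "abs_A3 (scale (1/2) (scale (1/2) (u * v))) = abs_A3 (scale (1/2) (scale (1/2) (v * u)))"
    by (simp flip: A3_scale.abs_eq)
  then have "abs_A3 ?x * abs_A3 ?y = abs_A3 ?y * abs_A3 ?x"
    by (simp add: times_A3.abs_eq scale_mult_left scale_mult_right)
  then have "A3_exp (abs_A3 ?x + abs_A3 ?y) = A3_exp (abs_A3 ?x) * A3_exp (abs_A3 ?y)"
    by (intro A3_exp_add_commuting) (simp_all add: u_def v_def var_def coeff_simps)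
  moreover have "?x + ?y = scale (1/2) (u + v)"
    by (rule ncps_eqI) (simp add: coeff_simps distrib_left)
  then have "abs_A3 ?x + abs_A3 ?y = (1/2) *\<^sub>A (abs_A3 u + abs_A3 v)"
    by (simp add: plus_A3.abs_eq A3_scale.abs_eq)
  ultimately show ?thesis
    by (simp add: uv add.assoc flip: A3_scale.abs_eq)
qed

lemma perm3_eqI:
  assumes "Perm.apply p 1 = Perm.apply q 1" "Perm.apply p 2 = Perm.apply q 2"
    "Perm.apply p 3 = Perm.apply q 3"
  shows "p = (q :: 3 perm)"
  using assms index3_cases by (metis perm_eqI)

section \<open>Inverses of semi-associators\<close>

lemma lie_series_const:
  assumes "f \<in> lie_series"
  shows "coeff f [] = 0"
proof -
  have "coeff g [] = 0" if "g \<in> lie_polynomials" for g :: "('a, 'b) ncps"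
    using that by induction (simp_all add: var_def coeff_simps commutator_def coeff_mult_Nil)
  then show ?thesis
    using adic_closureD[of f _ 1] assms unfolding lie_series_def by force
qed

lemma semi_associator_inverse:
  assumes "semi_associator \<Psi>"
  shows "\<Psi> * relabel swap_letters \<Psi> = 1" "relabel swap_letters \<Psi> * \<Psi> = 1"
proof -
  obtain \<psi> where "\<psi> \<in> lie_series" "\<Psi> = ncexp \<psi>"
    and inv: "relabel swap_letters \<Psi> = minv \<Psi>"
    using assms unfolding semi_associator_def by blast
  then have *: "\<Psi> * ncexp (- \<psi>) = 1" "ncexp (- \<psi>) * \<Psi> = 1"
    by (simp_all add: ncexp_uminus_inverse lie_series_const)
  then have "minv \<Psi> = ncexp (- \<psi>)" by (rule minv_eqI)
  with * inv show "\<Psi> * relabel swap_letters \<Psi> = 1" "relabel swap_letters \<Psi> * \<Psi> = 1"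
    by simp_all
qed

text \<open>
  The permutation \<open>321\<close> exchanges \<open>t\<^sub>1\<^sub>2\<close> and \<open>t\<^sub>2\<^sub>3\<close>, hence acts on series in these two
  variables as the exchange of \<open>A\<close> and \<open>B\<close>.
\<close>

lemma A3_act_321_subst_t:
  "A3_act (perm3 3 2 1) (subst_t f) = subst_t (relabel swap_letters f)"
proof -
  have "(edge_act (perm3 3 2 1) \<circ> letter_edge) x = (letter_edge \<circ> swap_letters) x" for x
    by (cases x)
      (simp_all add: edge_act_edge_of apply_perm3 del: One_nat_def,
        simp_all add: edge_of_def insert_commute)
  then have "edge_act (perm3 3 2 1) \<circ> letter_edge = letter_edge \<circ> swap_letters" by blast
  then show ?thesis by (simp add: subst_t_def A3_act.abs_eq relabel_relabel)
qed

section \<open>Drinfel'd's formula\<close>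

theorem mainTheorem5:
  fixes \<Psi> :: "(letter, 'k::field_char_0) ncps" and \<rho> :: "B3 \<Rightarrow> 'k A3S3"
  assumes "semi_associator \<Psi>"
    and "braid_representation \<rho>"
    and "\<rho> \<sigma>\<^sub>1 = A3_exp ((1/2) *\<^sub>A t 1 2) \<otimes> s1"
    and "\<rho> (\<sigma>\<^sub>1 * \<sigma>\<^sub>2 * \<sigma>\<^sub>1) =
      A3_exp ((1/2) *\<^sub>A (t 1 2 + t 1 3 + t 2 3)) * minv (subst_t \<Psi>) \<otimes> perm3 3 2 1"
  shows "\<rho> \<sigma>\<^sub>1 = A3_exp ((1/2) *\<^sub>A t 1 2) \<otimes> s1 \<and>
    \<rho> \<sigma>\<^sub>2 = (minv (subst_t \<Psi>) \<otimes> 1) * (A3_exp ((1/2) *\<^sub>A t 2 3) \<otimes> s2) * (subst_t \<Psi> \<otimes> 1)"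
proof -
  define P where "P = subst_t \<Psi>"
  define Q where "Q = A3_act (perm3 3 2 1) P"
  define e where "e i j = A3_exp ((1/2) *\<^sub>A t i j :: 'k A3)" for i j
  define X where "X = (Q \<otimes> 1) * (e 2 3 \<otimes> s2) * (P \<otimes> 1)"
  have PQ: "P * Q = 1" "Q * P = 1"
    unfolding P_def Q_def A3_act_321_subst_t
    by (simp_all add: semi_associator_inverse[OF assms(1)] subst_t_simps(3)
        flip: subst_t_simps(5))
  then have minvP: "minv P = Q" by (rule minv_eqI)
  have act_PQ: "A3_act p P * A3_act p Q = 1" "A3_act p Q * A3_act p P = 1" for p
    by (simp_all add: PQ flip: A3_act_mult)
  have minv_act: "minv (A3_act p P) = A3_act p Q" for p
    by (rule minv_eqI) (fact act_PQ)+
  have prods: "s1 * s2 = perm3 2 3 1" "perm3 2 3 1 * s1 = perm3 3 2 1"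
    "perm3 1 3 2 * perm3 3 2 1 = perm3 2 3 1" "s1 * perm3 3 2 1 = perm3 3 1 2"
    by (rule perm3_eqI; simp add: Perm.apply_times apply_perm3)+
  have act_e: "i \<noteq> j \<Longrightarrow> A3_act p (e i j) = e (Perm.apply p i) (Perm.apply p j)" for p i j
    by (simp add: e_def A3_act_exp A3_act_scale A3_act_t)
  have e_s1: "A3_act s1 (e 2 3) = e 1 3"
    by (simp add: act_e)
  have e_231: "A3_act (perm3 2 3 1) (e 1 2) = e 2 3"
    by (simp add: act_e apply_perm3)
  have P_231: "A3_act (perm3 2 3 1) P = A3_act (perm3 1 3 2) Q"
    by (simp add: Q_def A3_act_A3_act prods)
  have Q_s1: "A3_act s1 Q = A3_act (perm3 3 1 2) P"
    by (simp add: Q_def A3_act_A3_act prods)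
  have H3: "A3_exp ((1/2) *\<^sub>A (t 1 3 + t 2 3)) =
      A3_act (perm3 3 1 2) P * e 1 3 * A3_act (perm3 1 3 2) Q * e 2 3 * P"
    using assms(1) unfolding semi_associator_def by (simp add: P_def[symmetric] minv_act e_def)
  have "\<rho> \<sigma>\<^sub>1 * X * \<rho> \<sigma>\<^sub>1 =
      e 1 2 * A3_act s1 Q * A3_act s1 (e 2 3) * A3_act (s1 * s2) P *
        A3_act (s1 * s2) (e 1 2) \<otimes> s1 * s2 * s1"
    by (simp add: X_def assms(3) tensor_mult A3_act_mult A3_act_A3_act mult.assoc
        flip: e_def)
  also have "\<dots> = e 1 2 * (A3_act (perm3 3 1 2) P * e 1 3 * A3_act (perm3 1 3 2) Q * e 2 3 * P)
      * Q \<otimes> perm3 3 2 1"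
    by (simp add: prods e_s1 e_231 P_231 Q_s1 PQ mult.assoc)
  also have "\<dots> = \<rho> (\<sigma>\<^sub>1 * \<sigma>\<^sub>2 * \<sigma>\<^sub>1)"
    unfolding H3[symmetric] by (simp add: assms(4) minvP e_def A3_exp_T flip: P_def)
  also have "\<dots> = \<rho> \<sigma>\<^sub>1 * \<rho> \<sigma>\<^sub>2 * \<rho> \<sigma>\<^sub>1"
    using assms(2) by (simp add: braid_representation_def)
  finally have eq: "\<rho> \<sigma>\<^sub>1 * X * \<rho> \<sigma>\<^sub>1 = \<rho> \<sigma>\<^sub>1 * \<rho> \<sigma>\<^sub>2 * \<rho> \<sigma>\<^sub>1" .
  define R where "R = \<rho> (inverse \<sigma>\<^sub>1)"
  have R: "R * \<rho> \<sigma>\<^sub>1 = 1" "\<rho> \<sigma>\<^sub>1 * R = 1"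
    using assms(2) unfolding R_def braid_representation_def
    by (metis B3_left_inverse, metis B3_right_inverse)
  have "Z = R * (\<rho> \<sigma>\<^sub>1 * Z * \<rho> \<sigma>\<^sub>1) * R" for Z
    by (simp add: R mult.assoc) (simp add: R flip: mult.assoc)
  then have "\<rho> \<sigma>\<^sub>2 = X" using eq by metis
  then show ?thesis
    using assms(3) by (simp add: X_def e_def minvP flip: P_def)
qed

end
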